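(* Let $\mathbf T$ be a supercritical Galton–Watson tree without deaths and let $I$ be the invasion percolation cluster of $\mathbf T$. There is almost surely only one infinite non-backtracking path from the root $\mathbf 0$ in $I$. Equivalently, $\mathbf T$ is almost surely in the set of trees $T$ such that the invasion cluster $I^T$ of $T$ contains almost surely a unique infinite non-backtracking path from $\mathbf 0$.
   Context: The offspring variable $Z$ takes values in $\{1,2,\dots\}$, with $\mu:=\mathbf E[Z]>1$ and $\mathbf E[Z^2]<\infty$. Let $\mathcal V=\bigcup_{n\ge 0}\mathbb N^n$ be the vertex set of the Ulam–Harris tree, with root $\mathbf 0=\emptyset$. On $\Omega=(\mathbb N\times[0,1])^{\mathcal V}$ let $\mathbf P$ be the probability making the coordinates $(\deg_v,U_v)$, $v\in\mathcal V$, i.i.d. with the law of $(Z,U)$, where $U$ is uniform on $[0,1]$ and independent of $Z$. The Galton–Watson tree $\mathbf T$ is the random subtree containing $\mathbf 0$ and, for each $v\in\mathbf T$, exactly its first $\deg_v$ children. Invasion percolation on a tree $T$: $I^T_0=\{\mathbf 0\}$, and $I^T_{n+1}$ consists of $I^T_n$ together with the vertex of minimal weight $U_v$ among the vertices of $T$ adjacent to $I^T_n$ and not in it; $I^T=\bigcup_n I^T_n$, and $I:=I^{\mathbf T}$. *)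

theory Defs
  imports "HOL-Probability.Probability"
begin

text \<open>
  Vertices of the Ulam--Harris tree are finite words of naturals; the root is \<^term>\<open>[]\<close> and the
  children of \<open>v\<close> are \<open>v @ [i]\<close>. Labels start at 0, so the first \<open>d\<close> children of \<open>v\<close> are
  those with \<open>i < d\<close>.
\<close>

type_synonym vertex = "nat list"

definition adjacent :: "vertex \<Rightarrow> vertex \<Rightarrow> bool" where
  "adjacent u v \<longleftrightarrow> (\<exists>i. v = u @ [i]) \<or> (\<exists>i. u = v @ [i])"

inductive_set subtree :: "(vertex \<Rightarrow> nat) \<Rightarrow> vertex set" for deg :: "vertex \<Rightarrow> nat" where
  root: "[] \<in> subtree deg"
| child: "v \<in> subtree deg \<Longrightarrow> i < deg v \<Longrightarrow> v @ [i] \<in> subtree deg"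

text \<open>The locally finite rooted subtrees of the Ulam--Harris tree in which the children of
  every vertex form an initial segment.\<close>

definition plane_trees :: "vertex set set" where
  "plane_trees = range subtree"

definition outer_boundary :: "vertex set \<Rightarrow> vertex set \<Rightarrow> vertex set" where
  "outer_boundary T A = {v \<in> T - A. \<exists>u\<in>A. adjacent u v}"

text \<open>
  Each step adds the vertex of minimal weight on the outer boundary. Weights are almost surely
  pairwise distinct, so this minimiser is almost surely unique; on the exceptional null set
  all minimisers are added.
\<close>

primrec invasion_step :: "vertex set \<Rightarrow> (vertex \<Rightarrow> real) \<Rightarrow> nat \<Rightarrow> vertex set" where
  "invasion_step T U 0 = {[]}"
| "invasion_step T U (Suc n) = invasion_step T U n \<union>
     {v. is_arg_min U (\<lambda>w. w \<in> outer_boundary T (invasion_step T U n)) v}"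

definition invasion_cluster :: "vertex set \<Rightarrow> (vertex \<Rightarrow> real) \<Rightarrow> vertex set" where
  "invasion_cluster T U = (\<Union>n. invasion_step T U n)"

definition infinite_nonbacktracking_path :: "vertex set \<Rightarrow> (nat \<Rightarrow> vertex) \<Rightarrow> bool" where
  "infinite_nonbacktracking_path A \<gamma> \<longleftrightarrow>
     \<gamma> 0 = [] \<and> (\<forall>n. \<gamma> n \<in> A) \<and> (\<forall>n. adjacent (\<gamma> n) (\<gamma> (Suc n))) \<and>
     (\<forall>n. \<gamma> (Suc (Suc n)) \<noteq> \<gamma> n)"

definition uniform01 :: "real measure" where
  "uniform01 = uniform_measure lborel {0..1}"

definition gw_space :: "nat pmf \<Rightarrow> (vertex \<Rightarrow> nat \<times> real) measure" where
  "gw_space Z = Pi\<^sub>M UNIV (\<lambda>_. measure_pmf Z \<Otimes>\<^sub>M uniform01)"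

definition weight_space :: "(vertex \<Rightarrow> real) measure" where
  "weight_space = Pi\<^sub>M UNIV (\<lambda>_. uniform01)"

definition gw_tree :: "(vertex \<Rightarrow> nat \<times> real) \<Rightarrow> vertex set" where
  "gw_tree \<omega> = subtree (\<lambda>v. fst (\<omega> v))"

definition gw_weight :: "(vertex \<Rightarrow> nat \<times> real) \<Rightarrow> vertex \<Rightarrow> real" where
  "gw_weight \<omega> v = snd (\<omega> v)"

end

theory Submission
  imports Defs "HOL-Library.Sublist"
begin

text \<open>
  Say that \<open>v\<close> survives at level \<open>p\<close> if infinitely long paths of weights at most \<open>p\<close> lead
  downwards from \<open>v\<close>, its own weight included. If two rays of the invasion cluster separate at
  \<open>v\<close> into the children \<open>x\<close> and \<open>y\<close>, and \<open>x\<close> survives at level \<open>p\<close>, then from the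
  invasion of \<open>v\<close> on the boundary always contains a weight at most \<open>p\<close>, so every vertex
  of the other ray below \<open>v\<close> has weight at most \<open>p\<close> and \<open>y\<close> survives at level \<open>p\<close>
  too. Hence \<open>x\<close> and \<open>y\<close> survive at exactly the same levels.

  Survival of \<open>x\<close> and of \<open>y\<close> are independent, so it suffices that the critical survival level
  has no atoms. The survival probability at level \<open>p\<close> is the largest fixed point of
  \<open>y \<mapsto> p \<phi>(y)\<close> with \<open>\<phi>(y) = E[1 - (1 - y)^Z]\<close>. As \<open>\<phi>\<close> is strictly concave
  with \<open>\<phi>(0) = 0\<close>, the level \<open>y / \<phi>(y)\<close> has survival probability exactly \<open>y\<close>. Choosing
  the levels with survival probabilities \<open>k / m\<close>, \<open>k \<le> m\<close>, bounds the probability that two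
  siblings survive at the same levels by \<open>m (1/m)^2 = 1/m\<close>.
\<close>

section \<open>Rays of the invasion cluster\<close>

text \<open>Finite-depth truncation of survival: survival at level \<open>p\<close> is
  \<open>reaches p n v\<close> for all \<open>n\<close>, which agrees with the existence of an
  infinite path because degrees are finite. Membership of \<open>v\<close> in the tree is not asked
  for, so the event depends on the descendants of \<open>v\<close> alone.\<close>

primrec reaches :: "real \<Rightarrow> nat \<Rightarrow> vertex \<Rightarrow> (vertex \<Rightarrow> nat \<times> real) \<Rightarrow> bool" where
  "reaches p 0 v \<omega> \<longleftrightarrow> gw_weight \<omega> v \<le> p"
| "reaches p (Suc n) v \<omega> \<longleftrightarrow> gw_weight \<omega> v \<le> p \<and> (\<exists>i<fst (\<omega> v). reaches p n (v @ [i]) \<omega>)"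

lemma subtree_snoc_iff: "v @ [i] \<in> subtree deg \<longleftrightarrow> v \<in> subtree deg \<and> i < deg v"
  by (auto intro: subtree.child elim: subtree.cases)

text \<open>Closure under parents takes the place of connectedness. It makes every outer boundary
  vertex a child of a vertex of \<open>A\<close> and passes membership on to prefixes.\<close>

definition rooted_in :: "vertex set \<Rightarrow> vertex set \<Rightarrow> bool" where
  "rooted_in T A \<longleftrightarrow> [] \<in> A \<and> A \<subseteq> T \<and> (\<forall>v i. v @ [i] \<in> A \<longrightarrow> v \<in> A)"

lemma outer_boundary_iff:
  assumes "rooted_in T A"
  shows "v \<in> outer_boundary T A \<longleftrightarrow> v \<in> T - A \<and> (\<exists>u\<in>A. \<exists>i. v = u @ [i])"
  using assms unfolding rooted_in_def outer_boundary_def adjacent_def by blast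

lemma rooted_in_prefix:
  assumes "rooted_in T A"
  shows "v @ zs \<in> A \<Longrightarrow> v \<in> A"
  by (induction zs rule: rev_induct)
    (use assms in \<open>auto simp: rooted_in_def simp flip: append_assoc\<close>)

section \<open>The invasion never stops, and its cluster contains a ray\<close>

context
  fixes deg :: "vertex \<Rightarrow> nat" and U :: "vertex \<Rightarrow> real" and T :: "vertex set"
  assumes no_leaf: "\<And>v. deg v \<ge> 1"
  defines "T \<equiv> subtree deg"
begin

lemma rooted_in_invasion_step: "rooted_in T (invasion_step T U n)"
proof (induction n)
  case 0
  show ?case by (simp add: rooted_in_def T_def subtree.root)
next
  case (Suc n)
  have new: "v \<in> T \<and> (\<exists>u\<in>invasion_step T U n. \<exists>i. v = u @ [i])"
    if "v \<in> invasion_step T U (Suc n) - invasion_step T U n" for v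
    using that outer_boundary_iff[OF Suc, of v] by (auto simp: is_arg_min_def)
  show ?case
    unfolding rooted_in_def
  proof (intro conjI allI impI)
    show "[] \<in> invasion_step T U (Suc n)" using Suc by (simp add: rooted_in_def)
    show "invasion_step T U (Suc n) \<subseteq> T" using Suc new unfolding rooted_in_def by blast
  next
    fix v i assume "v @ [i] \<in> invasion_step T U (Suc n)"
    then have "v \<in> invasion_step T U n"
      using Suc new[of "v @ [i]"] by (auto simp: rooted_in_def)
    then show "v \<in> invasion_step T U (Suc n)" by simp
  qed
qed

lemma finite_outer_boundary:
  assumes "rooted_in T A" "finite A"
  shows "finite (outer_boundary T A)"
proof (rule finite_subset)
  show "outer_boundary T A \<subseteq> (\<Union>u\<in>A. (\<lambda>i. u @ [i]) ` {..<deg u})"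
    using outer_boundary_iff[OF assms(1)] by (fastforce simp: T_def subtree_snoc_iff)
qed (use assms in auto)

lemma finite_invasion_step: "finite (invasion_step T U n)"
proof (induction n)
  case (Suc n)
  have "{v. is_arg_min U (\<lambda>w. w \<in> outer_boundary T (invasion_step T U n)) v}
      \<subseteq> outer_boundary T (invasion_step T U n)"
    by (auto simp: is_arg_min_def)
  then show ?case
    using Suc finite_outer_boundary[OF rooted_in_invasion_step] by (simp add: finite_subset)
qed simp

text \<open>A deepest vertex of \<open>A\<close> has a first child, since there are no leaves, and
  that child is too deep to lie in \<open>A\<close>.\<close>

lemma outer_boundary_nonempty:
  assumes "rooted_in T A" "finite A"
  shows "outer_boundary T A \<noteq> {}"
proof -
  define m where "m = Max (length ` A)"
  have "[] \<in> A" using assms by (simp add: rooted_in_def)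
  then obtain v where v: "v \<in> A" "length v = m"
    using Max_in[of "length ` A"] assms unfolding m_def by fastforce
  have "v @ [0] \<notin> A"
    using v Max_ge[of "length ` A" "length (v @ [0])"] assms(2)
    unfolding m_def[symmetric] by (metis finite_imageI imageI length_append_singleton not_less_eq_eq order_refl)
  moreover have "v @ [0] \<in> T"
    using v assms no_leaf[of v] by (auto simp: T_def subtree_snoc_iff rooted_in_def)
  ultimately show ?thesis using v outer_boundary_iff[OF assms(1)] by blast
qed

lemma invasion_step_strict: "invasion_step T U n \<subset> invasion_step T U (Suc n)"
proof -
  let ?B = "outer_boundary T (invasion_step T U n)"
  have "finite ?B" "?B \<noteq> {}"
    using finite_outer_boundary outer_boundary_nonempty rooted_in_invasion_step
      finite_invasion_step by blast+
  then obtain v where "is_arg_min U (\<lambda>w. w \<in> ?B) v"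
    using ex_is_arg_min_if_finite by metis
  moreover from this have "v \<notin> invasion_step T U n"
    by (auto simp: is_arg_min_def outer_boundary_def)
  ultimately show ?thesis by auto
qed

lemma infinite_invasion_cluster: "infinite (invasion_cluster T U)"
proof
  assume fin: "finite (invasion_cluster T U)"
  have "n \<le> card (invasion_step T U n)" for n
  proof (induction n)
    case (Suc n)
    with psubset_card_mono[OF finite_invasion_step invasion_step_strict[of n]] show ?case
      by linarith
  qed simp
  moreover have "card (invasion_step T U n) \<le> card (invasion_cluster T U)" for n
    using fin by (intro card_mono) (auto simp: invasion_cluster_def)
  ultimately have "Suc (card (invasion_cluster T U)) \<le> card (invasion_cluster T U)"
    using le_trans by blast
  then show False by simp
qed

lemma rooted_in_invasion_cluster: "rooted_in T (invasion_cluster T U)"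
  using rooted_in_invasion_step unfolding rooted_in_def invasion_cluster_def by blast

text \<open>Koenig's lemma: a vertex with infinitely many cluster vertices below it has only
  finitely many children in the tree, so one of them inherits the property.\<close>

lemma ex_ray: "\<exists>\<gamma>. infinite_nonbacktracking_path (invasion_cluster T U) \<gamma>"
proof -
  let ?I = "invasion_cluster T U"
  let ?D = "\<lambda>v. {w \<in> ?I. prefix v w}"
  have step: "\<exists>w. infinite (?D w) \<and> (\<exists>i. w = v @ [i])" if "infinite (?D v)" for v
  proof (rule ccontr)
    assume "\<not> ?thesis"
    then have fin: "finite (insert v (\<Union>i<deg v. ?D (v @ [i])))" by blast
    have "w \<in> insert v (\<Union>i<deg v. ?D (v @ [i]))" if "w \<in> ?D v" for w
    proof (cases "w = v")
      case False
      with that obtain i zs where w: "w = v @ i # zs"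
        by (metis (no_types, lifting) mem_Collect_eq append_Nil2 list.exhaust prefixE)
      have "v @ [i] \<in> ?I"
        using rooted_in_prefix[OF rooted_in_invasion_cluster, of "v @ [i]" zs] that w by simp
      then have "v @ [i] \<in> T"
        using rooted_in_invasion_cluster by (auto simp: rooted_in_def)
      then have "i < deg v" by (simp add: T_def subtree_snoc_iff)
      with that w show ?thesis by auto
    qed simp
    with fin have "finite (?D v)" by (meson finite_subset subsetI)
    with that show False by simp
  qed
  have "\<exists>\<gamma>. \<forall>n. (infinite (?D (\<gamma> n)) \<and> (n = 0 \<longrightarrow> \<gamma> n = [])) \<and> (\<exists>i. \<gamma> (Suc n) = \<gamma> n @ [i])"
  proof (rule dependent_nat_choice)
    show "\<exists>x. infinite (?D x) \<and> ((0::nat) = 0 \<longrightarrow> x = [])"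
      using infinite_invasion_cluster by auto
  qed (use step in auto)
  then obtain \<gamma> where \<gamma>: "\<And>n. infinite (?D (\<gamma> n))" "\<gamma> 0 = []" "\<And>n. \<exists>i. \<gamma> (Suc n) = \<gamma> n @ [i]"
    by blast
  have "\<gamma> n \<in> ?I" for n
  proof -
    obtain w where "w \<in> ?D (\<gamma> n)" using \<gamma>(1)[of n] by (metis finite.emptyI all_not_in_conv)
    then show ?thesis
      using rooted_in_prefix[OF rooted_in_invasion_cluster] by (auto elim!: prefixE)
  qed
  moreover have "\<gamma> (Suc (Suc n)) \<noteq> \<gamma> n" for n
    using \<gamma>(3)[of n] \<gamma>(3)[of "Suc n"] by auto
  moreover have "adjacent (\<gamma> n) (\<gamma> (Suc n))" for n
    using \<gamma>(3)[of n] by (simp add: adjacent_def)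
  ultimately show ?thesis using \<gamma>(2) unfolding infinite_nonbacktracking_path_def by blast
qed

end

section \<open>Separating rays survive at the same levels\<close>

text \<open>The root has only children as neighbours, and after a downward step the only upward move
  would return to the previous vertex.\<close>

lemma nonbacktracking_path_child:
  assumes "infinite_nonbacktracking_path A \<gamma>"
  shows "\<exists>i. \<gamma> (Suc n) = \<gamma> n @ [i]"
proof (induction n)
  case 0
  then show ?case using assms unfolding infinite_nonbacktracking_path_def adjacent_def
    by (metis append_is_Nil_conv list.distinct(1))
next
  case (Suc n)
  have "adjacent (\<gamma> (Suc n)) (\<gamma> (Suc (Suc n)))" "\<gamma> (Suc (Suc n)) \<noteq> \<gamma> n"
    using assms unfolding infinite_nonbacktracking_path_def by blast+
  with Suc show ?case unfolding adjacent_def by force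
qed

text \<open>A path of weights at most \<open>p\<close> goes from \<open>u @ [i]\<close> down to
  depth \<open>length u + 1 + n\<close>, deeper than all of \<open>A\<close>. Its first vertex
  outside \<open>A\<close> is the required boundary vertex.\<close>

lemma reaches_meets_outer_boundary:
  assumes "rooted_in (gw_tree \<omega>) A" "u \<in> A" "u @ [i] \<in> gw_tree \<omega>" "reaches p n (u @ [i]) \<omega>"
    and "\<And>w. w \<in> A \<Longrightarrow> length w \<le> length u + n"
  shows "\<exists>b\<in>outer_boundary (gw_tree \<omega>) A. gw_weight \<omega> b \<le> p"
  using assms(2-)
proof (induction n arbitrary: u i)
  case 0
  then have "u @ [i] \<notin> A" by fastforce
  with 0 outer_boundary_iff[OF assms(1)] show ?case by auto
next
  case (Suc n)
  show ?case
  proof (cases "u @ [i] \<in> A")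
    case False
    with Suc.prems outer_boundary_iff[OF assms(1)] show ?thesis by auto
  next
    case True
    from Suc.prems obtain j where j: "j < fst (\<omega> (u @ [i]))" "reaches p n ((u @ [i]) @ [j]) \<omega>"
      by auto
    have "(u @ [i]) @ [j] \<in> gw_tree \<omega>"
      using Suc.prems(2) j(1) by (simp only: gw_tree_def subtree.child)
    moreover have "length w \<le> length (u @ [i]) + n" if "w \<in> A" for w
      using Suc.prems(4)[OF that] by simp
    ultimately show ?thesis using Suc.IH[OF True] j(2) by blast
  qed
qed

text \<open>When a proper descendant of \<open>v\<close> is invaded, \<open>v\<close> already is.
  The surviving child of \<open>v\<close> then provides a boundary vertex of weight at most
  \<open>p\<close>, and the invaded minimiser is no heavier.\<close>

lemma invaded_weight_le:
  assumes deg: "\<And>v. fst (\<omega> v) \<ge> 1" and child: "v @ [i] \<in> gw_tree \<omega>"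
    and reach: "\<And>n. reaches p n (v @ [i]) \<omega>"
    and inv: "v @ x # zs \<in> invasion_cluster (gw_tree \<omega>) (gw_weight \<omega>)"
  shows "gw_weight \<omega> (v @ x # zs) \<le> p"
proof -
  let ?I = "invasion_step (gw_tree \<omega>) (gw_weight \<omega>)"
  let ?w = "v @ x # zs"
  have root: "rooted_in (gw_tree \<omega>) (?I n)" and fin: "finite (?I n)" for n
    using rooted_in_invasion_step[of "\<lambda>v. fst (\<omega> v)"] finite_invasion_step[of "\<lambda>v. fst (\<omega> v)"] deg
    unfolding gw_tree_def by blast+
  obtain m where m: "?w \<in> ?I m" using inv by (auto simp: invasion_cluster_def)
  define k where "k = (LEAST m. ?w \<in> ?I m)"
  have k: "?w \<in> ?I k" "\<And>j. j < k \<Longrightarrow> ?w \<notin> ?I j"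
    unfolding k_def using LeastI[of "\<lambda>m. ?w \<in> ?I m", OF m] not_less_Least by auto
  then have "k \<noteq> 0" by (metis append_is_Nil_conv invasion_step.simps(1) list.distinct(1) singletonD)
  then obtain j where j: "k = Suc j" using not0_implies_Suc by blast
  have min: "is_arg_min (gw_weight \<omega>) (\<lambda>w. w \<in> outer_boundary (gw_tree \<omega>) (?I j)) ?w"
    using k(1) k(2)[of j] j by simp
  then obtain u y where uy: "u \<in> ?I j" "?w = u @ [y]"
    unfolding is_arg_min_def outer_boundary_iff[OF root] by blast
  \<comment> \<open>Since \<open>x # zs\<close> is nonempty, the parent \<open>u\<close> is
    \<open>v\<close> or lies below it, so \<open>v\<close> belongs to stage
    \<open>j\<close>.\<close>
  have "u = v @ butlast (x # zs)" using arg_cong[OF uy(2), of butlast] by (simp add: butlast_append)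
  then have v: "v \<in> ?I j" using uy(1) rooted_in_prefix[OF root] by blast
  define n where "n = Max (length ` ?I j)"
  have "\<And>w. w \<in> ?I j \<Longrightarrow> length w \<le> length v + n"
    using fin[of j] by (simp add: n_def trans_le_add2)
  then obtain b where "b \<in> outer_boundary (gw_tree \<omega>) (?I j)" "gw_weight \<omega> b \<le> p"
    using reaches_meets_outer_boundary[OF root v child reach] by blast
  with min show ?thesis unfolding is_arg_min_def by (meson not_le order_trans less_imp_le)
qed

lemma ray_reaches:
  assumes "\<And>k. \<gamma> (Suc k) = \<gamma> k @ [c k]" "\<And>k. \<gamma> k \<in> gw_tree \<omega>" "\<And>k. gw_weight \<omega> (\<gamma> k) \<le> p"
  shows "reaches p n (\<gamma> k) \<omega>"
proof (induction n arbitrary: k)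
  case (Suc n)
  have "c k < fst (\<omega> (\<gamma> k))"
    using assms(1)[of k] assms(2)[of "Suc k"] by (simp add: gw_tree_def subtree_snoc_iff)
  with assms(1)[of k] assms(3)[of k] Suc[of "Suc k"] show ?case by auto
qed (use assms in simp)

lemma ex1_ray:
  assumes deg: "\<And>v. fst (\<omega> v) \<ge> 1"
    and sep: "\<And>v i j. i \<noteq> j \<Longrightarrow>
      \<exists>p. \<not> ((\<forall>n. reaches p n (v @ [i]) \<omega>) \<longleftrightarrow> (\<forall>n. reaches p n (v @ [j]) \<omega>))"
  shows "\<exists>!\<gamma>. infinite_nonbacktracking_path (invasion_cluster (gw_tree \<omega>) (gw_weight \<omega>)) \<gamma>"
proof (rule ex_ex1I)
  let ?I = "invasion_cluster (gw_tree \<omega>) (gw_weight \<omega>)"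
  show "\<exists>\<gamma>. infinite_nonbacktracking_path ?I \<gamma>"
    using ex_ray[of "\<lambda>v. fst (\<omega> v)"] deg unfolding gw_tree_def by blast
  have sub: "?I \<subseteq> gw_tree \<omega>"
    using rooted_in_invasion_cluster[of "\<lambda>v. fst (\<omega> v)"] deg unfolding gw_tree_def rooted_in_def
    by blast
  \<comment> \<open>One direction of the comparison: if the child on \<open>\<gamma>\<close>
    survives at level \<open>p\<close>, all of \<open>\<delta>\<close> below the split has weight at
    most \<open>p\<close>, so \<open>\<delta>\<close> itself witnesses survival. Exchanging the rays
    gives the converse, against \<open>sep\<close>.\<close>
  have imp: "reaches p n (v @ [j]) \<omega>"
    if \<gamma>: "infinite_nonbacktracking_path ?I \<gamma>" and \<delta>: "infinite_nonbacktracking_path ?I \<delta>"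
      and eq: "\<delta> m = v" "\<gamma> (Suc m) = v @ [i]" "\<delta> (Suc m) = v @ [j]"
      and reach: "\<forall>n. reaches p n (v @ [i]) \<omega>" for \<gamma> \<delta> m v i j p n
  proof -
    have in_I: "\<gamma> k \<in> ?I" "\<delta> k \<in> ?I" for k
      using \<gamma> \<delta> unfolding infinite_nonbacktracking_path_def by blast+
    obtain c where c: "\<And>k. \<delta> (Suc k) = \<delta> k @ [c k]"
      using nonbacktracking_path_child[OF \<delta>] by metis
    have below: "\<exists>zs. \<delta> (Suc m + k) = v @ j # zs" for k
    proof (induction k)
      case (Suc k)
      then obtain zs where "\<delta> (Suc m + k) = v @ j # zs" by blast
      with c[of "Suc m + k"] show ?case by simp
    qed (use eq in simp)
    have "gw_weight \<omega> (\<delta> (Suc m + k)) \<le> p" for k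
    proof -
      obtain zs where zs: "\<delta> (Suc m + k) = v @ j # zs" using below by blast
      have "v @ [i] \<in> gw_tree \<omega>" using in_I(1)[of "Suc m"] sub eq(2) by auto
      then show ?thesis
        unfolding zs using reach in_I(2)[of "Suc m + k"] zs
        by (intro invaded_weight_le[OF deg]) auto
    qed
    then have "reaches p n (\<delta> (Suc m + 0)) \<omega>"
      using in_I(2) sub c[of "Suc m + _"]
      by (intro ray_reaches[of "\<lambda>k. \<delta> (Suc m + k)" "\<lambda>k. c (Suc m + k)" \<omega> p n 0]) auto
    with eq show ?thesis by simp
  qed
  show "\<gamma> = \<delta>"
    if \<gamma>: "infinite_nonbacktracking_path ?I \<gamma>" and \<delta>: "infinite_nonbacktracking_path ?I \<delta>" for \<gamma> \<delta>
  proof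
    show "\<gamma> m = \<delta> m" for m
    proof (induction m)
      case 0
      then show ?case using \<gamma> \<delta> unfolding infinite_nonbacktracking_path_def by simp
    next
      case (Suc m)
      obtain i j where ij: "\<gamma> (Suc m) = \<delta> m @ [i]" "\<delta> (Suc m) = \<delta> m @ [j]"
        using nonbacktracking_path_child[OF \<gamma>, of m] nonbacktracking_path_child[OF \<delta>, of m] Suc
        by metis
      show ?case
      proof (rule ccontr)
        assume "\<gamma> (Suc m) \<noteq> \<delta> (Suc m)"
        with ij have "i \<noteq> j" by auto
        then show False
          using sep[of i j "\<delta> m"] imp[OF \<gamma> \<delta> refl ij] imp[OF \<delta> \<gamma> Suc ij(2,1)] by blast
      qed
    qed
  qed
qed

section \<open>The survival probability\<close>

text \<open>The function \<phi> of the overview: the probability that some child survives when each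
  does so independently with probability \<open>x\<close>.\<close>

definition survival_map :: "nat pmf \<Rightarrow> real \<Rightarrow> real" where
  "survival_map Z x = measure_pmf.expectation Z (\<lambda>k. 1 - (1 - x) ^ k)"

lemma one_minus_power_bounds:
  fixes x :: real
  assumes "0 \<le> x" "x \<le> 1"
  shows "0 \<le> 1 - (1 - x) ^ k" "1 - (1 - x) ^ k \<le> 1" "norm (1 - (1 - x) ^ k) \<le> 1"
  using power_le_one[of "1 - x" k] zero_le_power[of "1 - x" k] assms by auto

lemma integrable_survival_map:
  fixes x :: real
  assumes "0 \<le> x" "x \<le> 1"
  shows "integrable (measure_pmf Z) (\<lambda>k. 1 - (1 - x) ^ k)"
  using one_minus_power_bounds[OF assms]
  by (intro measure_pmf.integrable_const_bound[where B = 1] AE_I2) auto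

lemma survival_map_mono:
  assumes "0 \<le> x" "x \<le> y" "y \<le> 1"
  shows "survival_map Z x \<le> survival_map Z y"
  unfolding survival_map_def
  by (intro integral_mono integrable_survival_map) (use assms in \<open>auto intro!: power_mono\<close>)

lemma survival_map_le_1:
  assumes "0 \<le> x" "x \<le> 1"
  shows "survival_map Z x \<le> 1"
  unfolding survival_map_def
  using one_minus_power_bounds[OF assms] by (intro measure_pmf.integral_le_const integrable_survival_map assms) auto

lemma survival_map_ge:
  assumes "0 \<le> x" "x \<le> 1" "set_pmf Z \<subseteq> {1..}"
  shows "x \<le> survival_map Z x"
  unfolding survival_map_def
proof (intro measure_pmf.integral_ge_const integrable_survival_map assms)
  have "(1 - x) ^ k \<le> 1 - x" if "k \<ge> 1" for k
    using power_decreasing[of 1 k "1 - x"] that assms by simp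
  then show "AE k in measure_pmf Z. x \<le> 1 - (1 - x) ^ k"
    using assms(3) by (force simp: AE_measure_pmf_iff)
qed

lemma tendsto_survival_map:
  assumes "X \<longlonglongrightarrow> x" "\<And>n. 0 \<le> X n" "\<And>n. X n \<le> 1"
  shows "(\<lambda>n. survival_map Z (X n)) \<longlonglongrightarrow> survival_map Z x"
  unfolding survival_map_def
proof (rule integral_dominated_convergence[where w = "\<lambda>_. 1"])
  show "AE k in measure_pmf Z. norm (1 - (1 - X n) ^ k) \<le> 1" for n
    using one_minus_power_bounds(3)[OF assms(2,3)] by blast
qed (auto intro!: tendsto_intros assms)

text \<open>Cross-multiplied form of the strict decrease of \<phi>(x)/x. For a fixed degree
  \<open>k\<close> this ratio is the geometric sum of \<open>(1 - x) ^ j\<close> over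
  \<open>j < k\<close>, nonincreasing in \<open>x\<close> and strictly decreasing once
  \<open>k\<close> is at least 2.\<close>

lemma survival_map_strict:
  assumes ab: "0 < a" "a < b" "b \<le> 1" and k: "k \<in> set_pmf Z" "k \<ge> 2"
  shows "a * survival_map Z b < b * survival_map Z a"
proof -
  let ?f = "\<lambda>k. b * (1 - (1 - a) ^ k) - a * (1 - (1 - b) ^ k)"
  have f: "?f k = a * b * ((\<Sum>j<k. (1 - a) ^ j) - (\<Sum>j<k. (1 - b) ^ j))" for k
    by (simp add: one_diff_power_eq algebra_simps)
  have nonneg: "?f k \<ge> 0" for k
    unfolding f using ab by (intro mult_nonneg_nonneg) (auto intro!: sum_mono power_mono)
  \<comment> \<open>The term \<open>j = 1\<close> is present because \<open>k\<close> is at least 2,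
    and it is strict.\<close>
  have "(\<Sum>j<k. (1 - b) ^ j) < (\<Sum>j<k. (1 - a) ^ j)"
    using ab k(2) by (intro sum_strict_mono_ex1) (auto intro!: power_mono bexI[of _ 1])
  then have pos: "?f k > 0" unfolding f using ab by simp
  have int: "integrable (measure_pmf Z) ?f"
    using ab by (intro Bochner_Integration.integrable_diff integrable_mult_right integrable_survival_map) auto
  have "measure_pmf.expectation Z ?f \<noteq> 0"
    using integral_nonneg_eq_0_iff_AE[OF int] nonneg pos k(1) by (force simp: AE_measure_pmf_iff)
  moreover have "measure_pmf.expectation Z ?f \<ge> 0" using nonneg by simp
  moreover have "measure_pmf.expectation Z ?f = b * survival_map Z a - a * survival_map Z b"
    unfolding survival_map_def using ab
    by (subst Bochner_Integration.integral_diff)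
      (auto intro!: integrable_mult_right integrable_survival_map simp del: right_diff_distrib)
  ultimately show ?thesis by simp
qed

lemma ex_offspring_ge_2:
  assumes "measure_pmf.expectation Z real > 1"
  shows "\<exists>k\<in>set_pmf Z. k \<ge> 2"
proof (rule ccontr)
  assume "\<not> ?thesis"
  then have "AE k in measure_pmf Z. real k \<le> 1" by (force simp: AE_measure_pmf_iff)
  \<comment> \<open>A non-integrable function has integral 0 by convention, so a mean above 1
    entails integrability.\<close>
  moreover have "integrable (measure_pmf Z) real"
    using assms not_integrable_integral_eq by fastforce
  ultimately show False using measure_pmf.integral_le_const[of Z real 1] assms by simp
qed

text \<open>The inverse of the survival probability as a function of the percolation parameter; the
  junk value \<open>0 / 0 = 0\<close> is the correct one at \<open>y = 0\<close>.\<close>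

definition survival_level :: "nat pmf \<Rightarrow> real \<Rightarrow> real" where
  "survival_level Z y = y / survival_map Z y"

lemma survival_level_bounds:
  assumes "0 \<le> y" "y \<le> 1" "set_pmf Z \<subseteq> {1..}"
  shows "y \<le> survival_level Z y" "survival_level Z y \<le> 1"
proof -
  have "y = 0 \<or> y > 0" using assms by auto
  moreover have "y > 0 \<Longrightarrow> y \<le> y / survival_map Z y \<and> y / survival_map Z y \<le> 1"
    using survival_map_ge[OF assms] survival_map_le_1[OF assms(1,2), of Z]
    by (auto simp: field_simps)
  ultimately show "y \<le> survival_level Z y" "survival_level Z y \<le> 1"
    by (auto simp: survival_level_def)
qed

text \<open>For positive \<open>y\<close>, the iterates start above the fixed point \<open>y\<close>
  and stay there by monotonicity; by continuity their limit is again a fixed point. Two distinct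
  positive fixed points would have equal ratios \<phi>(x)/x, which strict concavity forbids.\<close>

lemma iterate_survival_map_limit:
  assumes Z: "set_pmf Z \<subseteq> {1..}" "measure_pmf.expectation Z real > 1"
    and y: "0 \<le> y" "y \<le> 1"
    and g0: "g 0 = survival_level Z y"
    and gSuc: "\<And>n. g (Suc n) = survival_level Z y * survival_map Z (g n)"
    and g1: "\<And>n. 0 \<le> g n" "\<And>n. g n \<le> 1" and lim: "g \<longlonglongrightarrow> l"
  shows "l = y"
proof (cases "y = 0")
  case True
  then have "g n = 0" for n using g0 gSuc by (cases n) (auto simp: survival_level_def)
  then have "g = (\<lambda>_. 0)" by blast
  with lim True show ?thesis using LIMSEQ_unique tendsto_const by blast
next
  case False
  let ?p = "survival_level Z y"
  have y': "y > 0" using False y by simp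
  have fix_y: "y = ?p * survival_map Z y"
    using y' survival_map_ge[OF y Z(1)] by (simp add: survival_level_def)
  have p: "?p > 0" using survival_level_bounds(1)[OF y Z(1)] y' by simp
  have ge: "y \<le> g n" for n
  proof (induction n)
    case 0
    then show ?case using g0 survival_level_bounds(1)[OF y Z(1)] by simp
  next
    case (Suc n)
    have "?p * survival_map Z y \<le> ?p * survival_map Z (g n)"
      using Suc y g1 p by (intro mult_left_mono survival_map_mono) auto
    then show ?case using fix_y gSuc by simp
  qed
  have l: "y \<le> l" "l \<le> 1"
    using LIMSEQ_le_const[OF lim] LIMSEQ_le_const2[OF lim] ge g1 by blast+
  have "(\<lambda>n. g (Suc n)) \<longlonglongrightarrow> ?p * survival_map Z l"
    unfolding gSuc using lim g1 by (intro tendsto_intros tendsto_survival_map)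
  then have fix_l: "l = ?p * survival_map Z l"
    using LIMSEQ_unique LIMSEQ_Suc[OF lim] by blast
  show ?thesis
  proof (rule ccontr)
    assume "l \<noteq> y"
    obtain k where "k \<in> set_pmf Z" "k \<ge> 2" using ex_offspring_ge_2[OF Z(2)] by blast
    then have "y * survival_map Z l < l * survival_map Z y"
      using \<open>l \<noteq> y\<close> y' l by (intro survival_map_strict) auto
    then have "y * (?p * survival_map Z l) < l * (?p * survival_map Z y)"
      using p by (simp add: mult.left_commute)
    then show False using fix_l fix_y by (simp add: mult.commute)
  qed
qed

section \<open>Siblings survive at different levels\<close>

lemma prob_space_uniform01: "prob_space uniform01"
  unfolding uniform01_def by (rule prob_space_uniform_measure) auto

lemma sets_uniform01 [measurable_cong, simp]: "sets uniform01 = sets borel"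
  by (simp add: uniform01_def)

lemma space_uniform01 [simp]: "space uniform01 = UNIV"
  by (simp add: uniform01_def)

lemma measure_uniform01_atMost:
  assumes "0 \<le> p" "p \<le> 1"
  shows "measure uniform01 {..p} = p"
proof -
  have "{0..1} \<inter> {..p} = {0..p}" using assms by auto
  then show ?thesis unfolding uniform01_def using assms by (subst measure_uniform_measure) auto
qed

lemma indep_vars_PiM_component:
  assumes M: "\<And>i. prob_space (M i)"
  shows "prob_space.indep_vars (PiM UNIV M) M (\<lambda>i \<omega>. \<omega> i) UNIV"
proof -
  interpret prob_space "PiM UNIV M" using M by (rule prob_space_PiM)
  show ?thesis
    using M by (subst indep_vars_iff_distr_eq_PiM)
      (simp_all add: distr_PiM_component restrict_UNIV)
qed

text \<open>Restrictions to pairwise disjoint blocks of coordinates are independent; assumption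
  \<open>P\<close> says that event \<open>j\<close> factors through the restriction to
  \<open>K j\<close>.\<close>

lemma prob_PiM_indep:
  assumes M: "\<And>i. prob_space (M i)" and "finite J" "disjoint_family_on K J"
    and B: "\<And>j. j \<in> J \<Longrightarrow> {\<omega> \<in> space (PiM (K j) M). P j \<omega>} \<in> sets (PiM (K j) M)"
    and P: "\<And>j \<omega>. j \<in> J \<Longrightarrow> P j (restrict \<omega> (K j)) = P j \<omega>"
  shows "measure (PiM UNIV M) {\<omega> \<in> space (PiM UNIV M). \<forall>j\<in>J. P j \<omega>}
       = (\<Prod>j\<in>J. measure (PiM UNIV M) {\<omega> \<in> space (PiM UNIV M). P j \<omega>})"
proof (cases "J = {}")
  case False
  interpret prob_space "PiM UNIV M" using M by (rule prob_space_PiM)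
  have "indep_vars M (\<lambda>i \<omega>. \<omega> i) UNIV" using M by (rule indep_vars_PiM_component)
  then have "indep_vars (\<lambda>j. PiM (K j) M) (\<lambda>j \<omega>. restrict (\<lambda>i. \<omega> i) (K j)) J"
    using assms(3) by (intro indep_vars_restrict) auto
  then have "indep_events (\<lambda>j. {\<omega> \<in> space (PiM UNIV M). P j (restrict \<omega> (K j))}) J"
    by (rule indep_eventsI_indep_vars) (rule B)
  then have "prob (\<Inter>j\<in>J. {\<omega> \<in> space (PiM UNIV M). P j (restrict \<omega> (K j))})
      = (\<Prod>j\<in>J. prob {\<omega> \<in> space (PiM UNIV M). P j (restrict \<omega> (K j))})"
    using False assms(2) unfolding indep_events_def by blast
  moreover have "(\<Inter>j\<in>J. {\<omega> \<in> space (PiM UNIV M). P j (restrict \<omega> (K j))})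
      = {\<omega> \<in> space (PiM UNIV M). \<forall>j\<in>J. P j \<omega>}"
    using False P by auto
  ultimately show ?thesis using P by simp
next
  case True
  interpret prob_space "PiM UNIV M" using M by (rule prob_space_PiM)
  show ?thesis using True prob_space by simp
qed

lemma pmf_sums_expectation:
  fixes f :: "nat \<Rightarrow> real"
  assumes "integrable (measure_pmf Z) f"
  shows "(\<lambda>k. pmf Z k * f k) sums measure_pmf.expectation Z f"
proof -
  have "integrable (count_space UNIV) (\<lambda>k. pmf Z k * f k)"
    using assms unfolding measure_pmf_eq_density by (subst (asm) integrable_density) auto
  then have "(\<lambda>k. pmf Z k * f k) sums (\<integral>k. pmf Z k * f k \<partial>count_space UNIV)"
    by (rule sums_integral_count_space_nat)
  also have "(\<integral>k. pmf Z k * f k \<partial>count_space UNIV) = measure_pmf.expectation Z f"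
    unfolding measure_pmf_eq_density by (subst integral_density) auto
  finally show ?thesis .
qed

section \<open>Events determined by the descendants of a vertex\<close>

abbreviation descendants :: "vertex \<Rightarrow> vertex set" where
  "descendants v \<equiv> {w. prefix v w}"

lemma descendants_disjoint: "i \<noteq> j \<Longrightarrow> descendants (v @ [i]) \<inter> descendants (v @ [j]) = {}"
  by (auto simp: prefix_def)

lemma reaches_restrict:
  "descendants v \<subseteq> K \<Longrightarrow> reaches p n v (restrict \<omega> K) = reaches p n v \<omega>"
proof (induction n arbitrary: v)
  case (Suc n)
  have "v \<in> K" and "descendants (v @ [i]) \<subseteq> K" for i
    using Suc.prems by (auto simp: prefix_def)
  with Suc.IH show ?case by (simp add: gw_weight_def)
qed (auto simp: gw_weight_def)

lemma reaches_antimono: "reaches p (Suc n) v \<omega> \<Longrightarrow> reaches p n v \<omega>"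
proof (induction n arbitrary: v)
  case (Suc n)
  then obtain i where "i < fst (\<omega> v)" "reaches p (Suc n) (v @ [i]) \<omega>" "gw_weight \<omega> v \<le> p"
    using reaches.simps(2) by blast
  moreover from this have "reaches p n (v @ [i]) \<omega>" by (intro Suc.IH)
  ultimately show ?case by auto
qed simp

lemma reaches_mono: "p \<le> q \<Longrightarrow> reaches p n v \<omega> \<Longrightarrow> reaches q n v \<omega>"
  by (induction n arbitrary: v) auto

text \<open>The general index set \<open>K\<close> serves two uses: \<open>UNIV\<close> for the full
  space, and the descendants of \<open>v\<close> for independence.\<close>

lemma measurable_reaches:
  assumes "descendants v \<subseteq> K"
  shows "{\<omega> \<in> space (PiM K (\<lambda>_. measure_pmf Z \<Otimes>\<^sub>M uniform01)). reaches p n v \<omega>}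
    \<in> sets (PiM K (\<lambda>_. measure_pmf Z \<Otimes>\<^sub>M uniform01))"
  using assms
proof (induction n arbitrary: v)
  case 0
  then have "v \<in> K" by auto
  then show ?case unfolding reaches.simps gw_weight_def by measurable
next
  case (Suc n)
  then have v[measurable]: "v \<in> K" by auto
  have "descendants (v @ [i]) \<subseteq> K" for i using Suc.prems by (auto simp: prefix_def)
  note Suc.IH[OF this, measurable (raw)]
  then show ?case unfolding reaches.simps gw_weight_def by measurable
qed

section \<open>The law of survival and the comparison of siblings\<close>

context
  fixes Z :: "nat pmf"
begin

abbreviation node :: "(nat \<times> real) measure" where
  "node \<equiv> measure_pmf Z \<Otimes>\<^sub>M uniform01"

lemma prob_space_node: "prob_space node"
  by (rule prob_space_pair) (auto intro: prob_space_uniform01 measure_pmf.prob_space_axioms)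

lemma prob_space_gw: "prob_space (gw_space Z)"
  unfolding gw_space_def by (intro prob_space_PiM prob_space_node)

lemma space_gw [simp]: "space (gw_space Z) = UNIV"
  by (simp add: gw_space_def space_PiM space_pair_measure)

lemma sets_reaches: "{\<omega>. reaches p n v \<omega>} \<in> sets (gw_space Z)"
  using measurable_reaches[of v UNIV Z p n] unfolding gw_space_def[symmetric] by simp

lemma measure_node:
  assumes "A \<in> sets node"
  shows "measure (gw_space Z) {\<omega>. \<omega> v \<in> A} = measure node A"
proof -
  have "measure (distr (gw_space Z) node (\<lambda>\<omega>. \<omega> v)) A = measure (gw_space Z) {\<omega>. \<omega> v \<in> A}"
    using assms by (subst measure_distr) (auto simp: gw_space_def vimage_def space_PiM space_pair_measure)
  then show ?thesis
    using prob_space_node unfolding gw_space_def by (subst (asm) distr_PiM_component) auto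
qed

lemma sets_node_le:
  assumes "v \<in> K"
  shows "{\<omega> \<in> space (PiM K (\<lambda>_. node)). fst (\<omega> v) \<in> A \<and> gw_weight \<omega> v \<le> p}
    \<in> sets (PiM K (\<lambda>_. node))"
proof -
  have "(\<lambda>\<omega>. \<omega> v) -` (A \<times> {..p}) \<inter> space (PiM K (\<lambda>_. node)) \<in> sets (PiM K (\<lambda>_. node))"
    by (rule measurable_sets[OF measurable_component_singleton[OF assms]]) auto
  also have "(\<lambda>\<omega>. \<omega> v) -` (A \<times> {..p}) \<inter> space (PiM K (\<lambda>_. node))
      = {\<omega> \<in> space (PiM K (\<lambda>_. node)). fst (\<omega> v) \<in> A \<and> gw_weight \<omega> v \<le> p}"
    by (auto simp: gw_weight_def mem_Times_iff)
  finally show ?thesis .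
qed

lemma measure_node_le:
  assumes "0 \<le> p" "p \<le> 1"
  shows "measure (gw_space Z) {\<omega>. fst (\<omega> v) \<in> A \<and> gw_weight \<omega> v \<le> p} = measure (measure_pmf Z) A * p"
proof -
  interpret prob_space uniform01 by (rule prob_space_uniform01)
  have "measure (gw_space Z) {\<omega>. \<omega> v \<in> A \<times> {..p}} = measure node (A \<times> {..p})"
    by (rule measure_node) auto
  also have "\<dots> = measure (measure_pmf Z) A * measure uniform01 {..p}"
    unfolding measure_def by (subst emeasure_pair_measure_Times) (auto simp: enn2real_mult)
  finally show ?thesis
    using assms by (simp add: measure_uniform01_atMost gw_weight_def mem_Times_iff)
qed

text \<open>Split by the degree \<open>k\<close> of \<open>v\<close>. The node and its child
  subtrees are independent, so all \<open>k\<close> children fail with probability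
  \<open>(1 - g) ^ k\<close>; summing the complements over \<open>k\<close> gives the
  expectation.\<close>

lemma prob_reaches_Suc:
  assumes p: "0 \<le> p" "p \<le> 1"
    and g: "\<And>i. measure (gw_space Z) {\<omega>. reaches p n (v @ [i]) \<omega>} = g"
  shows "measure (gw_space Z) {\<omega>. reaches p (Suc n) v \<omega>} = p * survival_map Z g"
proof -
  interpret prob_space "gw_space Z" by (rule prob_space_gw)
  let ?F = "\<lambda>k. {\<omega>. fst (\<omega> v) \<in> {k} \<and> gw_weight \<omega> v \<le> p}"
  \<comment> \<open>The index \<open>None\<close> stands for the node \<open>v\<close>, and
    \<open>Some i\<close> for the subtree below its child \<open>i\<close>.\<close>
  let ?K = "case_option {v} (\<lambda>i. descendants (v @ [i]))"
  let ?P = "\<lambda>k. case_option (\<lambda>\<omega>. fst (\<omega> v) \<in> {k} \<and> gw_weight \<omega> v \<le> p)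
    (\<lambda>i \<omega>. \<not> reaches p n (v @ [i]) \<omega>)"
  let ?A = "\<lambda>k. {\<omega>. fst (\<omega> v) \<in> {k} \<and> gw_weight \<omega> v \<le> p \<and> (\<exists>i<k. reaches p n (v @ [i]) \<omega>)}"
  have g01: "0 \<le> g" "g \<le> 1" using g[of 0, symmetric] by auto
  have R: "{\<omega>. reaches p n w \<omega>} \<in> sets (gw_space Z)" for w by (rule sets_reaches)
  have F: "?F k \<in> sets (gw_space Z)" for k
    using sets_node_le[of v UNIV "{k}" p] unfolding gw_space_def[symmetric] by simp
  have A_eq: "?A k = ?F k - {\<omega>. \<forall>j\<in>insert None (Some ` {..<k}). ?P k j \<omega>}" for k
    by auto
  have no_child: "{\<omega>. \<forall>j\<in>insert None (Some ` {..<k}). ?P k j \<omega>}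
      = ?F k \<inter> (\<Inter>i\<in>{..<k}. space (gw_space Z) - {\<omega>. reaches p n (v @ [i]) \<omega>})" for k
    by auto
  have N: "{\<omega>. \<forall>j\<in>insert None (Some ` {..<k}). ?P k j \<omega>} \<in> sets (gw_space Z)" for k
    unfolding no_child using F R
    by (cases "k = 0") (auto intro!: sets.Int sets.finite_INT sets.Diff sets.top)
  have "prob {\<omega>. \<forall>j\<in>insert None (Some ` {..<k}). ?P k j \<omega>}
      = (\<Prod>j\<in>insert None (Some ` {..<k}). prob {\<omega>. ?P k j \<omega>})" for k
  proof -
    have "measure (PiM UNIV (\<lambda>_. node)) {\<omega> \<in> space (PiM UNIV (\<lambda>_. node)).
          \<forall>j\<in>insert None (Some ` {..<k}). ?P k j \<omega>}
      = (\<Prod>j\<in>insert None (Some ` {..<k}).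
          measure (PiM UNIV (\<lambda>_. node)) {\<omega> \<in> space (PiM UNIV (\<lambda>_. node)). ?P k j \<omega>})"
    proof (rule prob_PiM_indep[where K = ?K])
      show "disjoint_family_on ?K (insert None (Some ` {..<k}))"
        using descendants_disjoint by (auto simp: disjoint_family_on_def prefix_def)
    next
      fix j assume "j \<in> insert None (Some ` {..<k})"
      show "{\<omega> \<in> space (PiM (?K j) (\<lambda>_. node)). ?P k j \<omega>} \<in> sets (PiM (?K j) (\<lambda>_. node))"
      proof (cases j)
        case None
        with sets_node_le[of v "{v}" "{k}" p] show ?thesis by simp
      next
        case (Some i)
        show ?thesis
          using sets.compl_sets[OF measurable_reaches[of "v @ [i]" "descendants (v @ [i])" Z p n]] Some
          by (simp add: set_diff_eq Collect_conj_eq) (simp add: Int_def cong: conj_cong)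
      qed
    next
      fix j \<omega>
      show "?P k j (restrict \<omega> (?K j)) = ?P k j \<omega>"
        by (auto simp: reaches_restrict gw_weight_def split: option.split)
    qed (auto intro: prob_space_node)
    then show ?thesis unfolding gw_space_def[symmetric] by simp
  qed
  moreover have "prob {\<omega>. \<not> reaches p n (v @ [i]) \<omega>} = 1 - g" for i
    using prob_compl[OF R[of "v @ [i]"]] g[of i] by (simp add: Collect_neg_eq Compl_eq_Diff_UNIV)
  ultimately have "prob {\<omega>. \<forall>j\<in>insert None (Some ` {..<k}). ?P k j \<omega>}
      = pmf Z k * p * (1 - g) ^ k" for k
    using measure_node_le[OF p, of v "{k}"]
    by (simp add: prod.reindex pmf.rep_eq)
  then have "prob (?A k) = p * (pmf Z k * (1 - (1 - g) ^ k))" for k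
    unfolding A_eq using F N measure_node_le[OF p, of v "{k}"]
    by (subst finite_measure_Diff) (auto simp: pmf.rep_eq algebra_simps)
  moreover have "(\<lambda>k. prob (?A k)) sums prob (\<Union>k. ?A k)"
  proof (rule finite_measure_UNION)
    show "range ?A \<subseteq> sets (gw_space Z)" unfolding A_eq using F N by auto
  qed (auto simp: disjoint_family_on_def)
  moreover have "(\<Union>k. ?A k) = {\<omega>. reaches p (Suc n) v \<omega>}" by auto
  ultimately have "(\<lambda>k. p * (pmf Z k * (1 - (1 - g) ^ k))) sums prob {\<omega>. reaches p (Suc n) v \<omega>}"
    by simp
  moreover have "(\<lambda>k. p * (pmf Z k * (1 - (1 - g) ^ k))) sums (p * survival_map Z g)"
    unfolding survival_map_def
    by (intro sums_mult pmf_sums_expectation integrable_survival_map g01)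
  ultimately show ?thesis by (rule sums_unique2)
qed

primrec reach_prob :: "real \<Rightarrow> nat \<Rightarrow> real" where
  "reach_prob p 0 = p"
| "reach_prob p (Suc n) = p * survival_map Z (reach_prob p n)"

lemma prob_reaches:
  assumes "0 \<le> p" "p \<le> 1"
  shows "measure (gw_space Z) {\<omega>. reaches p n v \<omega>} = reach_prob p n"
proof (induction n arbitrary: v)
  case 0
  show ?case using measure_node_le[OF assms, of v UNIV] by simp
next
  case (Suc n)
  from prob_reaches_Suc[OF assms this] show ?case by simp
qed

text \<open>Survival is a decreasing intersection of the truncated events, so its probability is the
  limit of \<open>reach_prob\<close>, identified by the fixed-point argument.\<close>

lemma prob_survives:
  assumes Z: "set_pmf Z \<subseteq> {1..}" "measure_pmf.expectation Z real > 1"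
    and y: "0 \<le> y" "y \<le> 1"
  shows "measure (gw_space Z) {\<omega>. \<forall>n. reaches (survival_level Z y) n v \<omega>} = y"
proof -
  interpret prob_space "gw_space Z" by (rule prob_space_gw)
  let ?p = "survival_level Z y"
  have p: "0 \<le> ?p" "?p \<le> 1" using survival_level_bounds[OF y Z(1)] y by auto
  have "(\<lambda>n. prob {\<omega>. reaches ?p n v \<omega>}) \<longlonglongrightarrow> prob (\<Inter>n. {\<omega>. reaches ?p n v \<omega>})"
    using sets_reaches reaches_antimono
    by (intro finite_Lim_measure_decseq) (auto intro!: decseq_SucI)
  moreover have "(\<Inter>n. {\<omega>. reaches ?p n v \<omega>}) = {\<omega>. \<forall>n. reaches ?p n v \<omega>}" by auto
  ultimately have lim: "reach_prob ?p \<longlonglongrightarrow> prob {\<omega>. \<forall>n. reaches ?p n v \<omega>}"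
    using prob_reaches[OF p] by simp
  have "0 \<le> reach_prob ?p n" "reach_prob ?p n \<le> 1" for n
    using prob_reaches[OF p, of n v, symmetric] by auto
  then show ?thesis
    using lim by (intro iterate_survival_map_limit[OF Z y, of "reach_prob ?p"]) auto
qed

lemma sets_survives:
  assumes "descendants v \<subseteq> K"
  shows "{\<omega> \<in> space (PiM K (\<lambda>_. node)). \<forall>n. reaches p n v \<omega>} \<in> sets (PiM K (\<lambda>_. node))"
  by (intro sets.sets_Collect_countable_All measurable_reaches[OF assms])

text \<open>The levels \<open>c m k\<close> cut survival into \<open>m\<close> cells of probability
  at most \<open>1/m\<close>. Siblings surviving at the same levels share a cell up to null events,
  and by independence this has probability at most \<open>m * (1/m)^2\<close>.\<close>

lemma AE_separated:
  assumes Z: "set_pmf Z \<subseteq> {1..}" "measure_pmf.expectation Z real > 1" and "i \<noteq> j"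
  shows "AE \<omega> in gw_space Z.
    \<exists>p. \<not> ((\<forall>n. reaches p n (v @ [i]) \<omega>) \<longleftrightarrow> (\<forall>n. reaches p n (v @ [j]) \<omega>))"
proof -
  interpret prob_space "gw_space Z" by (rule prob_space_gw)
  define S where "S p x = {\<omega>. \<forall>n. reaches p n x \<omega>}" for p x
  define c where "c m k = survival_level Z (real k / real m)" for m k
  define D where "D m k x = S (c m (Suc k)) x - S (c m k) x" for m k x
  \<comment> \<open>The last two sets are null: survival has probability 1 at the top level and 0 at
    the bottom one.\<close>
  define B where "B m = (\<Union>k<m. D m k (v @ [i]) \<inter> D m k (v @ [j])) \<union> (UNIV - S (c m m) (v @ [i]))
    \<union> S (c m 0) (v @ [i])" for m
  have S: "S p x \<in> sets (gw_space Z)" for p x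
    using sets_survives[of x UNIV p] unfolding S_def gw_space_def[symmetric] by simp
  have D: "D m k x \<in> sets (gw_space Z)" for m k x unfolding D_def using S by auto
  have B: "B m \<in> sets (gw_space Z)" for m
    unfolding B_def using D S sets.compl_sets[OF S] by auto
  have prob_S: "prob (S (c m k) x) = real k / real m" if "k \<le> m" "m > 0" for m k x
    unfolding S_def c_def using that by (intro prob_survives[OF Z]) auto
  have prob_D: "prob (D m k x) \<le> 1 / real m" if "k < m" for m k x
  \<comment> \<open>Monotonicity of \<open>c m\<close> need not be established: if the two levels
    came in reverse order, the cell would be empty.\<close>
  proof (cases "c m k \<le> c m (Suc k)")
    case True
    then have "S (c m k) x \<subseteq> S (c m (Suc k)) x" unfolding S_def using reaches_mono[OF True] by blast
    then have "prob (D m k x) = prob (S (c m (Suc k)) x) - prob (S (c m k) x)"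
      unfolding D_def by (intro finite_measure_Diff S)
    then show ?thesis using that by (simp add: prob_S field_simps)
  next
    case False
    then have "c m (Suc k) \<le> c m k" by simp
    then have "S (c m (Suc k)) x \<subseteq> S (c m k) x" unfolding S_def using reaches_mono by blast
    then have "D m k x = {}" unfolding D_def by blast
    then show ?thesis by simp
  qed
  have indep: "prob (D m k (v @ [i]) \<inter> D m k (v @ [j])) = prob (D m k (v @ [i])) * prob (D m k (v @ [j]))"
    for m k
  proof -
    let ?P = "\<lambda>l \<omega>. (\<forall>n. reaches (c m (Suc k)) n (v @ [l]) \<omega>) \<and>
      \<not> (\<forall>n. reaches (c m k) n (v @ [l]) \<omega>)"
    have P: "D m k (v @ [l]) = {\<omega>. ?P l \<omega>}" for l by (auto simp: D_def S_def)
    have "measure (PiM UNIV (\<lambda>_. node)) {\<omega> \<in> space (PiM UNIV (\<lambda>_. node)). \<forall>l\<in>{i, j}. ?P l \<omega>}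
      = (\<Prod>l\<in>{i, j}. measure (PiM UNIV (\<lambda>_. node)) {\<omega> \<in> space (PiM UNIV (\<lambda>_. node)). ?P l \<omega>})"
    proof (rule prob_PiM_indep[where K = "\<lambda>l. descendants (v @ [l])"])
      show "disjoint_family_on (\<lambda>l. descendants (v @ [l])) {i, j}"
        using descendants_disjoint by (auto simp: disjoint_family_on_def)
    next
      fix l
      show "{\<omega> \<in> space (PiM (descendants (v @ [l])) (\<lambda>_. node)). ?P l \<omega>}
          \<in> sets (PiM (descendants (v @ [l])) (\<lambda>_. node))"
        by (intro sets.sets_Collect_conj sets.sets_Collect_neg sets_survives) auto
    qed (auto simp: reaches_restrict intro: prob_space_node)
    then show ?thesis
      unfolding gw_space_def[symmetric] P using \<open>i \<noteq> j\<close> by (simp add: Int_def)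
  qed
  have prob_B: "prob (B m) \<le> 1 / real m" if m: "m > 0" for m
  proof -
    have "prob (B m) \<le> prob (\<Union>k<m. D m k (v @ [i]) \<inter> D m k (v @ [j]))
        + prob (UNIV - S (c m m) (v @ [i])) + prob (S (c m 0) (v @ [i]))"
      unfolding B_def using D S sets.compl_sets[OF S]
      by (intro order_trans[OF measure_Un_le] add_right_mono measure_Un_le) auto
    also have "prob (UNIV - S (c m m) (v @ [i])) = 0"
      using prob_compl[OF S] m prob_S[of m m] by simp
    also have "prob (S (c m 0) (v @ [i])) = 0" using m prob_S[of 0 m] by simp
    also have "prob (\<Union>k<m. D m k (v @ [i]) \<inter> D m k (v @ [j]))
        \<le> (\<Sum>k<m. prob (D m k (v @ [i]) \<inter> D m k (v @ [j])))"
      using D by (intro finite_measure_subadditive_finite) auto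
    also have "\<dots> \<le> (\<Sum>k<m. 1 / real m * (1 / real m))"
      unfolding indep by (intro sum_mono mult_mono prob_D) auto
    also have "\<dots> = 1 / real m" using m by simp
    finally show ?thesis by simp
  qed
  have sub: "\<omega> \<in> B m"
    if eq: "\<And>p. \<omega> \<in> S p (v @ [i]) \<longleftrightarrow> \<omega> \<in> S p (v @ [j])" for \<omega> m
  proof (rule ccontr)
    assume "\<omega> \<notin> B m"
    then have *: "\<omega> \<in> S (c m m) (v @ [i])" "\<omega> \<notin> S (c m 0) (v @ [i])"
      "\<And>k. k < m \<Longrightarrow> \<omega> \<notin> D m k (v @ [i]) \<inter> D m k (v @ [j])"
      unfolding B_def by auto
    \<comment> \<open>Without a shared cell, failure to survive propagates from the bottom level to
      the top.\<close>
    have "k \<le> m \<Longrightarrow> \<omega> \<notin> S (c m k) (v @ [i])" for k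
    proof (induction k)
      case (Suc k)
      with *(3)[of k] eq show ?case by (auto simp: D_def)
    qed (use * in simp)
    with *(1) show False by blast
  qed
  let ?N = "\<Inter>m. B (Suc m)"
  have N: "?N \<in> sets (gw_space Z)" using B by (intro sets.countable_INT) auto
  have "prob ?N \<le> 1 / real (Suc m)" for m
  proof -
    have "prob ?N \<le> prob (B (Suc m))" by (rule finite_measure_mono[OF _ B]) blast
    with prob_B[of "Suc m"] show ?thesis by simp
  qed
  then have "prob ?N \<le> 0"
    by (intro LIMSEQ_le_const[OF LIMSEQ_Suc[OF lim_inverse_n']]) blast
  then have "?N \<in> null_sets (gw_space Z)"
    using N by (auto simp: null_sets_def emeasure_eq_measure measure_le_0_iff)
  then show ?thesis
    by (rule AE_I') (use sub in \<open>auto simp: S_def\<close>)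
qed

end

section \<open>Resampling the weights\<close>

text \<open>Checked on cylinders. The sets \<open>A i\<close> need not be rectangles, so they are
  sliced at fixed first components; independence of the coordinates then factors the integral of the
  product of slice measures.\<close>

lemma distr_PiM_pair:
  assumes M: "\<And>i. prob_space (M i)" and N: "\<And>i. prob_space (N i)"
  shows "distr (PiM UNIV M \<Otimes>\<^sub>M PiM UNIV N) (PiM UNIV (\<lambda>i. M i \<Otimes>\<^sub>M N i)) (\<lambda>x i. (fst x i, snd x i))
       = PiM UNIV (\<lambda>i. M i \<Otimes>\<^sub>M N i)"
proof (rule measure_eqI_PiM_infinite)
  interpret PM: prob_space "PiM UNIV M" using M by (rule prob_space_PiM)
  interpret PN: prob_space "PiM UNIV N" using N by (rule prob_space_PiM)
  let ?P = "PiM UNIV M \<Otimes>\<^sub>M PiM UNIV N"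
  let ?Q = "PiM UNIV (\<lambda>i. M i \<Otimes>\<^sub>M N i)"
  let ?f = "\<lambda>x i. (fst x i, snd x i)"
  have f[measurable]: "?f \<in> measurable ?P ?Q"
    by (rule measurable_PiM_single') (auto simp: space_pair_measure space_PiM)
  have "prob_space ?P"
    by (rule prob_space_pair) (rule PM.prob_space_axioms PN.prob_space_axioms)+
  then show "finite_measure (distr ?P ?Q ?f)"
    using prob_space.prob_space_distr[OF _ f] prob_space.finite_measure by blast
  fix A J
  assume J: "finite J" and A: "\<And>i. i \<in> J \<Longrightarrow> A i \<in> sets (M i \<Otimes>\<^sub>M N i)"
  let ?X = "prod_emb UNIV (\<lambda>i. M i \<Otimes>\<^sub>M N i) J (Pi\<^sub>E J A)"
  have X[measurable]: "?X \<in> sets ?Q" using J A by (intro sets_PiM_I) auto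
  have slice: "Pair x -` (?f -` ?X \<inter> space ?P)
      = prod_emb UNIV N J (Pi\<^sub>E J (\<lambda>i. Pair (x i) -` A i))" if "x \<in> space (PiM UNIV M)" for x
    using that by (auto simp: prod_emb_def PiE_iff space_PiM space_pair_measure)
  have "emeasure (distr ?P ?Q ?f) ?X = emeasure ?P (?f -` ?X \<inter> space ?P)"
    by (rule emeasure_distr) measurable
  also have "\<dots> = (\<integral>\<^sup>+x. emeasure (PiM UNIV N) (Pair x -` (?f -` ?X \<inter> space ?P)) \<partial>PiM UNIV M)"
    by (rule PN.emeasure_pair_measure_alt) measurable
  also have "\<dots> = (\<integral>\<^sup>+x. (\<Prod>i\<in>J. emeasure (N i) (Pair (x i) -` A i)) \<partial>PiM UNIV M)"
    using J A N by (intro nn_integral_cong)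
      (subst slice, simp, rule emeasure_PiM_emb, auto intro: sets_Pair1)
  also have "\<dots> = (\<Prod>i\<in>J. \<integral>\<^sup>+x. emeasure (N i) (Pair (x i) -` A i) \<partial>PiM UNIV M)"
  proof (rule PM.indep_vars_nn_integral[OF J])
    have "PM.indep_vars M (\<lambda>i \<omega>. \<omega> i) J"
      using indep_vars_PiM_component[OF M] by (rule PM.indep_vars_subset) simp
    then show "PM.indep_vars (\<lambda>_. borel) (\<lambda>i \<omega>. emeasure (N i) (Pair (\<omega> i) -` A i)) J"
      by (rule PM.indep_vars_compose2)
        (rule sigma_finite_measure.measurable_emeasure_Pair[OF prob_space_imp_sigma_finite[OF N] A])
  qed simp
  also have "\<dots> = (\<Prod>i\<in>J. emeasure (M i \<Otimes>\<^sub>M N i) (A i))"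
  proof (rule prod.cong[OF refl])
    fix i assume i: "i \<in> J"
    have meas: "(\<lambda>x. emeasure (N i) (Pair x -` A i)) \<in> borel_measurable (M i)"
      by (rule sigma_finite_measure.measurable_emeasure_Pair[OF prob_space_imp_sigma_finite[OF N] A[OF i]])
    have "(\<integral>\<^sup>+x. emeasure (N i) (Pair (x i) -` A i) \<partial>PiM UNIV M)
        = (\<integral>\<^sup>+x. emeasure (N i) (Pair x -` A i) \<partial>distr (PiM UNIV M) (M i) (\<lambda>x. x i))"
      using meas by (subst nn_integral_distr) auto
    also have "\<dots> = (\<integral>\<^sup>+x. emeasure (N i) (Pair x -` A i) \<partial>M i)"
      using M by (subst distr_PiM_component) auto
    also have "\<dots> = emeasure (M i \<Otimes>\<^sub>M N i) (A i)"
      by (rule sigma_finite_measure.emeasure_pair_measure_alt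
          [OF prob_space_imp_sigma_finite[OF N] A[OF i], symmetric])
    finally show "(\<integral>\<^sup>+x. emeasure (N i) (Pair (x i) -` A i) \<partial>PiM UNIV M)
        = emeasure (M i \<Otimes>\<^sub>M N i) (A i)" .
  qed
  also have "\<dots> = emeasure ?Q ?X"
    using J A M N by (intro emeasure_PiM_emb[symmetric] prob_space_pair) auto
  finally show "emeasure (distr ?P ?Q ?f) ?X = emeasure ?Q ?X" .
qed auto

text \<open>Fubini on the split product space, pulled back along the first components. It replaces
  the weights by fresh ones independent of the degrees.\<close>

lemma AE_PiM_pair_resample:
  assumes M: "\<And>i. prob_space (M i)" and N: "\<And>i. prob_space (N i)"
    and AE: "AE \<omega> in PiM UNIV (\<lambda>i. M i \<Otimes>\<^sub>M N i). P (\<lambda>i. fst (\<omega> i)) (\<lambda>i. snd (\<omega> i))"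
  shows "AE \<omega> in PiM UNIV (\<lambda>i. M i \<Otimes>\<^sub>M N i). AE y in PiM UNIV N. P (\<lambda>i. fst (\<omega> i)) y"
proof -
  interpret PM: prob_space "PiM UNIV M" using M by (rule prob_space_PiM)
  interpret PN: prob_space "PiM UNIV N" using N by (rule prob_space_PiM)
  interpret pair_sigma_finite "PiM UNIV M" "PiM UNIV N" ..
  let ?P = "PiM UNIV M \<Otimes>\<^sub>M PiM UNIV N"
  let ?Q = "PiM UNIV (\<lambda>i. M i \<Otimes>\<^sub>M N i)"
  let ?f = "\<lambda>x i. (fst x i, snd x i)"
  let ?h = "\<lambda>\<omega> i. fst (\<omega> i)"
  have f: "?f \<in> measurable ?P ?Q"
    by (rule measurable_PiM_single') (auto simp: space_pair_measure space_PiM)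
  have h: "?h \<in> measurable ?Q (PiM UNIV M)"
    by (rule measurable_PiM_single') (auto simp: space_pair_measure space_PiM PiE_iff mem_Times_iff)
  have "AE \<omega> in distr ?P ?Q ?f. P (\<lambda>i. fst (\<omega> i)) (\<lambda>i. snd (\<omega> i))"
    using AE unfolding distr_PiM_pair[OF M N] .
  then have "AE x in ?P. P (fst x) (snd x)" using AE_distrD[OF f] by fastforce
  then have AE1: "AE x in PiM UNIV M. AE y in PiM UNIV N. P x y" using AE_pair by fastforce
  have "distr ?Q (PiM UNIV M) ?h = distr ?P (PiM UNIV M) (?h \<circ> ?f)"
    by (subst distr_PiM_pair[OF M N, symmetric], rule distr_distr[OF h f])
  also have "?h \<circ> ?f = fst" by (simp add: fun_eq_iff)
  finally have distr_h: "distr ?Q (PiM UNIV M) ?h = PiM UNIV M" by (simp add: PN.distr_pair_fst)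
  show ?thesis
    by (rule AE_distrD[OF h, where P = "\<lambda>x. AE y in PiM UNIV N. P x y"]) (unfold distr_h, rule AE1)
qed

theorem corollary2p5:
  fixes Z :: "nat pmf"
  assumes no_deaths: "set_pmf Z \<subseteq> {1..}"
    and supercritical: "measure_pmf.expectation Z real > 1"
    and second_moment: "integrable (measure_pmf Z) (\<lambda>k. (real k)\<^sup>2)"
  shows "(AE \<omega> in gw_space Z.
            \<exists>!\<gamma>. infinite_nonbacktracking_path (invasion_cluster (gw_tree \<omega>) (gw_weight \<omega>)) \<gamma>)
       \<and> (AE \<omega> in gw_space Z.
            gw_tree \<omega> \<in> {T \<in> plane_trees. AE U in weight_space.
              \<exists>!\<gamma>. infinite_nonbacktracking_path (invasion_cluster T U) \<gamma>})"
proof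
  interpret U: prob_space uniform01 by (rule prob_space_uniform01)
  have "AE k in distr (measure_pmf Z \<Otimes>\<^sub>M uniform01) (measure_pmf Z) fst. 1 \<le> k"
    unfolding U.distr_pair_fst using no_deaths by (auto simp: AE_measure_pmf_iff)
  then have "AE x in measure_pmf Z \<Otimes>\<^sub>M uniform01. 1 \<le> fst x"
    by (intro AE_distrD[of fst]) auto
  then have "AE \<omega> in gw_space Z. 1 \<le> fst (\<omega> v)" for v
    unfolding gw_space_def by (intro AE_PiM_component) (auto intro: prob_space_node)
  then have "AE \<omega> in gw_space Z. \<forall>v. 1 \<le> fst (\<omega> v)"
    by (simp add: AE_all_countable)
  moreover have "AE \<omega> in gw_space Z. \<forall>v i j. i \<noteq> j \<longrightarrow>
      (\<exists>p. \<not> ((\<forall>n. reaches p n (v @ [i]) \<omega>) \<longleftrightarrow> (\<forall>n. reaches p n (v @ [j]) \<omega>)))"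
    using AE_separated[OF no_deaths supercritical] unfolding AE_all_countable by auto
  ultimately show AE: "AE \<omega> in gw_space Z.
      \<exists>!\<gamma>. infinite_nonbacktracking_path (invasion_cluster (gw_tree \<omega>) (gw_weight \<omega>)) \<gamma>"
    by eventually_elim (rule ex1_ray, auto)
  \<comment> \<open>The tree depends on the degrees alone, so the uniqueness statement has the form
    needed for resampling the weights.\<close>
  let ?P = "\<lambda>d U. \<exists>!\<gamma>. infinite_nonbacktracking_path (invasion_cluster (subtree d) U) \<gamma>"
  have "AE \<omega> in gw_space Z. ?P (\<lambda>v. fst (\<omega> v)) (\<lambda>v. snd (\<omega> v))"
    using AE unfolding gw_tree_def gw_weight_def .
  then have "AE \<omega> in gw_space Z. AE U in weight_space. ?P (\<lambda>v. fst (\<omega> v)) U"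
    unfolding gw_space_def weight_space_def
    by (intro AE_PiM_pair_resample measure_pmf.prob_space_axioms prob_space_uniform01)
  then show "AE \<omega> in gw_space Z. gw_tree \<omega> \<in> {T \<in> plane_trees. AE U in weight_space.
      \<exists>!\<gamma>. infinite_nonbacktracking_path (invasion_cluster T U) \<gamma>}"
    unfolding gw_tree_def plane_trees_def by simp
qed

end
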